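(* For every partition $\lambda$, if $S_\lambda=\sum_\mu a^\lambda_\mu X^\mu$ is the expansion of $S_\lambda$ into monomials, then $$S_{\lambda'}=\sum_\mu(-1)^{|\lambda|-|\mu|}a^\lambda_\mu X^\mu.$$
   Context: Let $K$ be a field of characteristic $0$ and $P=K[X_1,X_2,\dots]$. For a vector $\mu=(\mu_1,\dots,\mu_m)$ of non-negative integers put $X^\mu=X_1^{\mu_1}\cdots X_m^{\mu_m}$ and $|\mu|=\mu_1+\cdots+\mu_m$ (vectors differing by trailing zeros are identified). For a partition $\lambda$, $|\lambda|$ is its size and $\lambda'$ its conjugate partition. Define $H_d\in P$ ($d\ge0$) by $\sum_{d\ge0}H_dt^d=\prod_{i\ge1}(1-t^i)^{-X_i}$ in $P[[t]]$, where $(1-t^i)^{-X_i}=\sum_{j\ge 0}\binom{X_i+j-1}{j}t^{ij}$, and $H_d=0$ for $d<0$. For $\lambda=(\lambda_1,\dots,\lambda_l)$, $S_\lambda=\det(H_{\lambda_i+j-i})_{1\le i,j\le l}\in P$; this is the character polynomial of the family of restrictions to $S_n$ of the Weyl modules $W_\lambda(K^n)$. *)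

theory Defs
  imports
    "HOL-Library.Poly_Mapping"
    "HOL-Computational_Algebra.Formal_Power_Series"
    "HOL-Analysis.Infinite_Products"
    "Jordan_Normal_Form.Determinant"
begin

text \<open>
  Vectors of exponents up to trailing zeros are finitely supported functions, and the
  polynomial ring \<open>K[X\<^sub>1, X\<^sub>2, \<dots>]\<close> is the monoid algebra over them.  Since indices of type
  \<^typ>\<open>nat\<close> start at 0, index \<open>i\<close> stands for the variable \<open>X\<^sub>i\<^sub>+\<^sub>1\<close>; the monomial \<open>c X\<^sup>\<mu>\<close> is
  \<open>Poly_Mapping.single \<mu> c\<close>.
\<close>

type_synonym exponent = "nat \<Rightarrow>\<^sub>0 nat"

type_synonym 'k polys = "exponent \<Rightarrow>\<^sub>0 'k"

definition exponent_size :: "exponent \<Rightarrow> nat" where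
  "exponent_size \<mu> = (\<Sum>i\<in>Poly_Mapping.keys \<mu>. Poly_Mapping.lookup \<mu> i)"

definition const :: "'k::zero \<Rightarrow> 'k polys" where
  "const c = Poly_Mapping.single 0 c"

definition var :: "nat \<Rightarrow> 'k::zero_neq_one polys" where
  "var i = Poly_Mapping.single (Poly_Mapping.single i 1) 1"

text \<open>
  The binomial coefficient \<open>p (p - 1) \<cdots> (p - j + 1) / j!\<close> of a polynomial \<open>p\<close>; \<^const>\<open>gbinomial\<close>
  is not available because the polynomial ring has no division operation.
\<close>

definition poly_binomial :: "'k::field_char_0 polys \<Rightarrow> nat \<Rightarrow> 'k polys" where
  "poly_binomial p j = const (1 / fact j) * (\<Prod>k<j. p - of_nat k)"

text \<open>
  \<open>(1 - t\<^sup>m)\<^sup>-\<^sup>x = \<Sum>\<^sub>j binomial(x + j - 1, j) t\<^sup>m\<^sup>j\<close>, obtained by substituting \<open>t\<^sup>m\<close>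
  (where \<open>m \<ge> 1\<close>) into the series for \<open>m = 1\<close>.
\<close>

definition neg_power_series :: "nat \<Rightarrow> 'k::field_char_0 polys \<Rightarrow> 'k polys fps" where
  "neg_power_series m x =
     fps_compose (Abs_fps (\<lambda>j. poly_binomial (x + of_nat j - 1) j)) (fps_X ^ m)"

text \<open>The infinite product is taken in the \<open>t\<close>-adic topology on power series.\<close>

definition H_series :: "'k::field_char_0 polys fps" where
  "H_series = prodinf (\<lambda>i. neg_power_series (Suc i) (var i))"

definition H_poly :: "int \<Rightarrow> 'k::field_char_0 polys" where
  "H_poly d = (if d < 0 then 0 else fps_nth H_series (nat d))"

definition is_partition :: "nat list \<Rightarrow> bool" where
  "is_partition lam \<longleftrightarrow> sorted_wrt (\<ge>) lam \<and> (\<forall>p\<in>set lam. p > 0)"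

definition conj_partition :: "nat list \<Rightarrow> nat list" where
  "conj_partition lam =
     map (\<lambda>j. card {i. i < length lam \<and> j \<le> lam ! i}) [1..<Suc (foldr max lam 0)]"

text \<open>Matrix indices start at 0; the offset \<open>j - i\<close> does not depend on this.\<close>

definition S_poly :: "nat list \<Rightarrow> 'k::field_char_0 polys" where
  "S_poly lam = det (mat (length lam) (length lam)
     (\<lambda>(i, j). H_poly (int (lam ! i) + int j - int i)))"

text \<open>The infinite product defining \<^const>\<open>H_series\<close> converges, so it is not a junk value.\<close>

lemma neg_power_series_nth:
  assumes "m > 0"
  shows "fps_nth (neg_power_series m x) n =
    (if m dvd n then poly_binomial (x + of_nat (n div m) - 1) (n div m) else 0)"
proof -
  have "fps_nth (neg_power_series m x) n =
     (\<Sum>i=0..n. poly_binomial (x + of_nat i - 1) i * (if n = m * i then 1 else 0))"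
    unfolding neg_power_series_def fps_compose_nth
    by (simp add: power_mult [symmetric])
  also have "\<dots> = (\<Sum>i\<in>{0..n}. if i = n div m \<and> m dvd n
      then poly_binomial (x + of_nat i - 1) i else 0)"
    using assms by (intro sum.cong) auto
  also have "\<dots> = (if m dvd n then poly_binomial (x + of_nat (n div m) - 1) (n div m) else 0)"
    by (cases "m dvd n") auto
  finally show ?thesis .
qed

lemma neg_power_series_nth_less:
  assumes "n < m"
  shows "fps_nth (neg_power_series m x) n = (if n = 0 then 1 else 0)"
proof -
  have "m > 0" using assms by simp
  then show ?thesis using assms
    by (auto simp: neg_power_series_nth poly_binomial_def const_def dest: dvd_imp_le)
qed

lemma has_prod_H_series:
  "(\<lambda>i. neg_power_series (Suc i) (var i)) has_prod (H_series :: 'k::field_char_0 polys fps)"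
proof -
  define f where "f = (\<lambda>i. neg_power_series (Suc i) (var i :: 'k polys))"
  define p where "p = (\<lambda>N. \<Prod>i\<le>N. f i)"
  have low: "fps_nth (f i) n = (if n = 0 then 1 else 0)" if "n \<le> i" for i n
    using that by (simp add: f_def neg_power_series_nth_less)
  have step: "fps_nth (p (Suc N)) n = fps_nth (p N) n" if "n \<le> Suc N" for N n
  proof -
    have "fps_nth (p (Suc N)) n = (\<Sum>i=0..n. fps_nth (p N) i * fps_nth (f (Suc N)) (n - i))"
      by (simp add: p_def fps_mult_nth)
    also have "\<dots> = (\<Sum>i\<in>{0..n}. if i = n then fps_nth (p N) i else 0)"
      using that by (intro sum.cong) (auto simp: low)
    finally show ?thesis by simp
  qed
  have stable: "fps_nth (p N) n = fps_nth (p n) n" if "n \<le> N" for N n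
    using that by (induction N rule: dec_induct) (auto simp: step)
  define q where "q = Abs_fps (\<lambda>n. fps_nth (p n) n)"
  have "p \<longlonglongrightarrow> q"
  proof (rule tendsto_fpsI)
    fix n
    have "fps_nth (p N) n = fps_nth q n" if "n \<le> N" for N
      using stable[OF that] by (simp add: q_def)
    then show "\<forall>\<^sub>F N in sequentially. fps_nth (p N) n = fps_nth q n"
      unfolding eventually_sequentially by blast
  qed
  moreover have "fps_nth q 0 = 1"
    by (simp add: q_def p_def low)
  then have "q \<noteq> 0" by auto
  ultimately have "f has_prod q"
    by (simp add: has_prod_def raw_has_prod_def p_def)
  moreover from this have "H_series = q"
    using has_prod_unique[of f q] by (simp add: H_series_def f_def)
  ultimately show ?thesis by (simp add: f_def)
qed

end

theory Submission
  imports Defs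
begin

text \<open>
  Let \<open>\<sigma>\<close> be the ring endomorphism \<open>X\<^sub>i \<mapsto> -X\<^sub>i\<close> of the polynomial ring; it multiplies the
  coefficient of \<open>X\<^sup>\<mu>\<close> by \<open>(-1)\<^bsup>\<bar>\<mu>\<bar>\<^esup>\<close>, so the claim says
  \<open>S\<^bsub>\<lambda>'\<^esub> = (-1)\<^bsup>\<bar>\<lambda>\<bar>\<^esup> \<sigma>(S\<^sub>\<lambda>)\<close>.

  Since \<open>(1 - t\<^sup>i)\<close> to the powers \<open>-x\<close> and \<open>x\<close> are inverse to each other, applying \<open>\<sigma>\<close> to
  the coefficients of the product \<open>H(t)\<close> inverts it (\<open>negate_vars_fps_H_series_mult\<close>).  In the
  language of symmetric functions, if \<open>H\<^sub>d\<close> is read as the complete function \<open>h\<^sub>d\<close>, then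
  \<open>\<sigma>(H\<^sub>d)\<close> is \<open>(-1)\<^sup>d e\<^sub>d\<close> with the elementary function \<open>e\<^sub>d\<close>.  The theorem thus is the
  equality of the Jacobi-Trudi determinant of \<open>\<lambda>'\<close> and the dual Jacobi-Trudi determinant of
  \<open>\<lambda>\<close>.

  That equality (\<open>dual_Jacobi_Trudi\<close>) holds for any two power series with
  constant term 1 inverse to each other.
  Their Toeplitz matrices are inverse to each other, and the two determinants are complementary
  minors of these matrices: the rows of one and the columns of the other are the labels of the
  vertical and of the horizontal edges of the boundary path of \<open>\<lambda>\<close>, which together
  exhaust all labels.  By Jacobi's theorem on complementary minors they agree up to the sign of a
  permutation, whose parity is that of the number of cells of \<open>\<lambda>\<close> (\<open>sign_edge_label\<close>).
\<close>

section \<open>Products of Toeplitz matrices\<close>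

definition coeff_ext :: "'a::zero fps \<Rightarrow> int \<Rightarrow> 'a" where
  "coeff_ext F d = (if d < 0 then 0 else fps_nth F (nat d))"

text \<open>
  An entry of the product of two truncated Toeplitz matrices.  Both are upper triangular, so
  truncating them at any \<open>N\<close> beyond \<open>a\<close> and \<open>b\<close> loses no term of the convolution.
\<close>

lemma coeff_ext_mult:
  fixes F G :: "'a::semiring_1 fps"
  assumes "a < N" "b < N"
  shows "(\<Sum>k<N. coeff_ext F (int k - int a) * coeff_ext G (int b - int k)) =
    coeff_ext (F * G) (int b - int a)"
proof (cases "a \<le> b")
  case True
  have "(\<Sum>k<N. coeff_ext F (int k - int a) * coeff_ext G (int b - int k)) =
      (\<Sum>k\<in>{a..b}. coeff_ext F (int k - int a) * coeff_ext G (int b - int k))"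
    using assms by (intro sum.mono_neutral_right) (auto simp: coeff_ext_def)
  also have "\<dots> = (\<Sum>i\<in>{0..b - a}. fps_nth F i * fps_nth G (b - a - i))"
  proof (rule sum.reindex_bij_witness[where i = "\<lambda>i. i + a" and j = "\<lambda>k. k - a"])
    fix k assume "k \<in> {a..b}"
    then show "fps_nth F (k - a) * fps_nth G (b - a - (k - a)) =
      coeff_ext F (int k - int a) * coeff_ext G (int b - int k)"
      by (auto simp: coeff_ext_def nat_diff_distrib)
  qed (use True in auto)
  finally show ?thesis
    using True by (simp add: coeff_ext_def fps_mult_nth nat_diff_distrib)
next
  case False
  then have "coeff_ext F (int k - int a) * coeff_ext G (int b - int k) = 0" for k
    by (auto simp: coeff_ext_def)
  then show ?thesis
    using False by (simp add: coeff_ext_def)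
qed

section \<open>Edge labels of the boundary path of a partition\<close>

text \<open>
  A partition with at most \<open>l\<close> parts is given by a weakly decreasing function on \<open>{..<l}\<close>, so
  that trailing zeros are allowed.
\<close>

definition conj_entry :: "nat \<Rightarrow> (nat \<Rightarrow> nat) \<Rightarrow> nat \<Rightarrow> nat" where
  "conj_entry l f j = card {i. i < l \<and> j < f i}"

text \<open>
  The Young diagram sits in a box of \<open>l\<close> rows and \<open>m\<close> columns; its boundary path from the top
  right to the bottom left corner has \<open>l + m\<close> edges, labelled \<open>0, 1, \<dots>\<close> along the path.  The
  argument \<open>i < l\<close> stands for the vertical edge ending row \<open>i\<close>, the argument \<open>l + j\<close> for the
  horizontal edge ending column \<open>j\<close>.  Other arguments are fixed, as required of a permutation of
  \<open>{0..<l + m}\<close>.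
\<close>

definition edge_label :: "nat \<Rightarrow> nat \<Rightarrow> (nat \<Rightarrow> nat) \<Rightarrow> nat \<Rightarrow> nat" where
  "edge_label l m f i =
     (if i < l then m + i - f i
      else if i < l + m then (l + m - 1 - i) + conj_entry l f (i - l)
      else i)"

lemma conj_entry_le: "conj_entry l f j \<le> l"
proof -
  have "card {i. i < l \<and> j < f i} \<le> card {..<l}"
    by (intro card_mono) auto
  then show ?thesis by (simp add: conj_entry_def)
qed

lemma less_conj_entry_iff:
  assumes f: "antimono_on {..<l} f" and "i < l"
  shows "i < conj_entry l f j \<longleftrightarrow> j < f i"
proof
  assume j: "j < f i"
  have "{..i} \<subseteq> {i. i < l \<and> j < f i}"
  proof
    fix k assume "k \<in> {..i}"
    then have "k < l" "f i \<le> f k"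
      using \<open>i < l\<close> f by (auto simp: monotone_on_def)
    then show "k \<in> {i. i < l \<and> j < f i}" using j by simp
  qed
  then have "card {..i} \<le> conj_entry l f j"
    unfolding conj_entry_def by (intro card_mono) auto
  then show "i < conj_entry l f j" by simp
next
  assume *: "i < conj_entry l f j"
  show "j < f i"
  proof (rule ccontr)
    assume j: "\<not> j < f i"
    have "{i. i < l \<and> j < f i} \<subseteq> {..<i}"
    proof
      fix k assume k: "k \<in> {i. i < l \<and> j < f i}"
      then have "f k \<le> f i" if "i \<le> k"
        using that \<open>i < l\<close> f by (auto simp: monotone_on_def)
      then show "k \<in> {..<i}" using j k by (cases "i \<le> k") auto
    qed
    then have "conj_entry l f j \<le> card {..<i}"
      unfolding conj_entry_def by (intro card_mono) auto
    then show False using * by simp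
  qed
qed

lemma edge_label_less:
  assumes "i < l + m"
  shows "edge_label l m f i < l + m"
  using assms conj_entry_le[of l f "i - l"] by (auto simp: edge_label_def)

text \<open>
  A vertical edge of row \<open>i\<close> and a horizontal edge of column \<open>j\<close> have different labels because
  the cell \<open>(i, j)\<close> is inside the diagram or outside of it: the vertical edge comes strictly
  earlier on the path in the first case and strictly later in the second one.
\<close>

lemma edge_label_inj:
  assumes f: "antimono_on {..<l} f" and le: "\<And>i. i < l \<Longrightarrow> f i \<le> m"
  shows "inj_on (edge_label l m f) {..<l + m}"
proof (rule linorder_inj_onI)
  fix i j assume "i < j" and ij: "i \<in> {..<l + m}" "j \<in> {..<l + m}"
  consider "j < l" | "i < l" "l \<le> j" | "l \<le> i" by linarith
  then show "edge_label l m f i \<noteq> edge_label l m f j"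
  proof cases
    case 1
    then have "f j \<le> f i" using f \<open>i < j\<close> by (auto simp: monotone_on_def)
    with 1 \<open>i < j\<close> le[of i] le[of j] show ?thesis by (simp add: edge_label_def)
  next
    case 2
    then show ?thesis
      using less_conj_entry_iff[OF f, of i "j - l"] le[of i] ij
      by (cases "j - l < f i") (auto simp: edge_label_def)
  next
    case 3
    have "conj_entry l f (j - l) \<le> conj_entry l f (i - l)"
      unfolding conj_entry_def using \<open>i < j\<close> 3 by (intro card_mono) auto
    with 3 \<open>i < j\<close> ij show ?thesis by (simp add: edge_label_def)
  qed
qed auto

lemma edge_label_permutes:
  assumes "antimono_on {..<l} f" "\<And>i. i < l \<Longrightarrow> f i \<le> m"
  shows "edge_label l m f permutes {0..<l + m}"
proof (rule bij_imp_permutes)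
  have inj: "inj_on (edge_label l m f) {0..<l + m}"
    using edge_label_inj assms by (metis lessThan_atLeast0)
  moreover have "edge_label l m f ` {0..<l + m} = {0..<l + m}"
    using inj by (intro endo_inj_surj) (auto intro: edge_label_less)
  ultimately show "bij_betw (edge_label l m f) {0..<l + m} {0..<l + m}"
    by (simp add: bij_betw_def)
qed (auto simp: edge_label_def)

text \<open>
  Removing one corner cell replaces a vertical edge followed by a horizontal one by a horizontal
  edge followed by a vertical one.  This exchanges two labels and so flips the sign; after
  \<open>\<Sum>i<l. f i\<close> removals the empty diagram is left.
\<close>

lemma sign_edge_label:
  assumes "antimono_on {..<l} f" "\<And>i. i < l \<Longrightarrow> f i \<le> m"
  shows "sign (edge_label l m f) = (-1) ^ (\<Sum>i<l. f i) * sign (edge_label l m (\<lambda>_. 0))"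
  using assms
proof (induction "\<Sum>i<l. f i" arbitrary: f)
  case 0
  then have z: "\<And>i. i < l \<Longrightarrow> f i = 0" by auto
  then have "conj_entry l f j = conj_entry l (\<lambda>_. 0) j" for j
    unfolding conj_entry_def by (intro arg_cong[of _ _ card]) auto
  with z have "edge_label l m f = edge_label l m (\<lambda>_. 0)"
    by (auto simp: edge_label_def fun_eq_iff)
  then show ?case using 0 by simp
next
  case (Suc n)
  \<comment> \<open>The last nonempty row \<open>r\<close> ends in a corner cell.\<close>
  define r where "r = Max {i. i < l \<and> 0 < f i}"
  have "{i. i < l \<and> 0 < f i} \<noteq> {}"
  proof
    assume "{i. i < l \<and> 0 < f i} = {}"
    then have "(\<Sum>i<l. f i) = 0" by auto
    then show False using Suc.hyps(2) by simp
  qed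
  then have "r \<in> {i. i < l \<and> 0 < f i}"
    unfolding r_def by (intro Max_in) auto
  then have r: "r < l" "0 < f r" by auto
  have after: "f i = 0" if "r < i" "i < l" for i
  proof (rule ccontr)
    assume "f i \<noteq> 0"
    then have "i \<le> r" unfolding r_def using that by (intro Max_ge) auto
    then show False using that by simp
  qed
  define g where "g = f(r := f r - 1)"
  \<comment> \<open>The argument that stands for the column of this cell.\<close>
  define s where "s = l + (f r - 1)"
  have g_anti: "antimono_on {..<l} g"
  proof (rule monotone_onI)
    fix i k assume ik: "i \<in> {..<l}" "k \<in> {..<l}" "i \<le> k"
    then have "f k \<le> f i" using Suc.prems(1) by (auto simp: monotone_on_def)
    moreover have "f k = 0" if "i = r" "k \<noteq> r" using after[of k] ik that by auto
    ultimately show "g k \<le> g i" by (auto simp: g_def)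
  qed
  have g_le: "g i \<le> m" if "i < l" for i
    using Suc.prems(2)[OF that] Suc.prems(2)[OF r(1)] by (auto simp: g_def)
  have sum_f: "(\<Sum>i<l. f i) = Suc (\<Sum>i<l. g i)"
  proof -
    have "(\<Sum>i<l. f i) = f r + (\<Sum>i\<in>{..<l} - {r}. f i)"
      using r by (intro sum.remove) auto
    moreover have "(\<Sum>i<l. g i) = g r + (\<Sum>i\<in>{..<l} - {r}. g i)"
      using r by (intro sum.remove) auto
    moreover have "(\<Sum>i\<in>{..<l} - {r}. g i) = (\<Sum>i\<in>{..<l} - {r}. f i)"
      by (intro sum.cong) (auto simp: g_def)
    ultimately show ?thesis using r by (simp add: g_def)
  qed
  have s: "l \<le> s" "s < l + m" "r \<noteq> s"
    using r Suc.prems(2)[OF r(1)] by (auto simp: s_def)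
  have f_at: "conj_entry l f (f r - 1) = Suc r"
  proof -
    have "{i. i < l \<and> f r - 1 < f i} = {..r}"
    proof (intro equalityI subsetI)
      fix i assume "i \<in> {i. i < l \<and> f r - 1 < f i}"
      then show "i \<in> {..r}" using after[of i] by (cases "r < i") auto
    next
      fix i assume "i \<in> {..r}"
      then have "f r \<le> f i" using Suc.prems(1) r by (auto simp: monotone_on_def)
      then show "i \<in> {i. i < l \<and> f r - 1 < f i}" using \<open>i \<in> {..r}\<close> r by auto
    qed
    then show ?thesis by (simp add: conj_entry_def)
  qed
  have g_at: "conj_entry l g (f r - 1) = r"
  proof -
    have "{i. i < l \<and> f r - 1 < g i} = {i. i < l \<and> f r - 1 < f i} - {r}"
      by (auto simp: g_def)
    moreover have "card ({i. i < l \<and> f r - 1 < f i} - {r}) = Suc r - 1"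
      using r f_at by (subst card_Diff_singleton) (auto simp: conj_entry_def)
    ultimately show ?thesis by (simp add: conj_entry_def)
  qed
  have g_off: "conj_entry l g j = conj_entry l f j" if "j \<noteq> f r - 1" for j
  proof -
    have "{i. i < l \<and> j < g i} = {i. i < l \<and> j < f i}"
      using that by (auto simp: g_def split: if_splits)
    then show ?thesis by (simp add: conj_entry_def)
  qed
  have "edge_label l m f = edge_label l m g \<circ> Transposition.transpose r s"
  proof
    fix i
    consider "i = r" | "i = s" | "i \<noteq> r" "i \<noteq> s" by blast
    then show "edge_label l m f i = (edge_label l m g \<circ> Transposition.transpose r s) i"
    proof cases
      case 1
      then show ?thesis
        using r s g_at Suc.prems(2)[OF r(1)] by (simp add: edge_label_def s_def)
    next
      case 2
      then show ?thesis
        using r s f_at Suc.prems(2)[OF r(1)] by (simp add: edge_label_def s_def g_def)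
    next
      case 3
      then have "conj_entry l g (i - l) = conj_entry l f (i - l)" if "l \<le> i"
        using that by (intro g_off) (auto simp: s_def)
      then show ?thesis using 3 by (auto simp: edge_label_def g_def)
    qed
  qed
  moreover have "permutation (edge_label l m g)"
    using edge_label_permutes[OF g_anti g_le] by (auto simp: permutation_permutes)
  ultimately have "sign (edge_label l m f) = - sign (edge_label l m g)"
    using s by (simp add: sign_compose permutation_swap_id sign_swap_id)
  moreover have "sign (edge_label l m g) = (-1) ^ (\<Sum>i<l. g i) * sign (edge_label l m (\<lambda>_. 0))"
    using Suc.hyps(2) sum_f g_anti g_le by (intro Suc.hyps(1)) auto
  ultimately show ?case using sum_f by simp
qed

section \<open>The dual Jacobi-Trudi identity\<close>

lemma det_permute_rows_cols:
  fixes A :: "'a::comm_ring_1 mat"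
  assumes A: "A \<in> carrier_mat n n" and p: "p permutes {0..<n}" and q: "q permutes {0..<n}"
  shows "det (mat n n (\<lambda>(i, j). A $$ (p i, q j))) = signof p * signof q * det A"
proof -
  let ?B = "mat n n (\<lambda>(i, j). A\<^sup>T $$ (q i, j))"
  have pq: "p i < n" "q i < n" if "i < n" for i
    using that permutes_in_image[OF p, of i] permutes_in_image[OF q, of i] by auto
  have "mat n n (\<lambda>(i, j). A $$ (p i, q j)) = mat n n (\<lambda>(i, j). ?B\<^sup>T $$ (p i, j))"
    using A pq by (intro eq_matI) auto
  also have "det \<dots> = signof p * det ?B"
    using p by (subst det_permute_rows[of _ n]) (auto simp: det_transpose[of _ n])
  also have "det ?B = signof q * det A"
    using A q by (subst det_permute_rows[of _ n]) (auto simp: det_transpose[of _ n])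
  finally show ?thesis by (simp add: mult.assoc)
qed

lemma det_coeff_ext_Toeplitz:
  fixes F :: "'a::idom fps"
  assumes "fps_nth F 0 = 1"
  shows "det (mat n n (\<lambda>(i, j). coeff_ext F (int j - int i))) = 1"
proof -
  let ?T = "mat n n (\<lambda>(i, j). coeff_ext F (int j - int i))"
  have "upper_triangular ?T"
    by (auto simp: upper_triangular_def coeff_ext_def)
  then have "det ?T = prod_list (diag_mat ?T)"
    by (intro det_upper_triangular[of _ n]) auto
  also have "diag_mat ?T = map (\<lambda>_. 1) [0..<n]"
    using assms by (auto simp: diag_mat_def coeff_ext_def)
  finally show ?thesis by (simp add: map_replicate_const)
qed

text \<open>
  Jacobi's theorem on complementary minors in the form needed here.  Let \<open>A\<close> be the Toeplitz matrix
  of \<open>F\<close> with rows ordered by the edge labels \<open>w\<close> of the diagram and columns by the labels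
  \<open>c\<close> of the empty diagram, and let \<open>B\<close> be the identity matrix with its last \<open>m\<close> columns
  replaced by those of the inverse of \<open>A\<close>, which consists of coefficients of \<open>G\<close>.  In block form
  this reads
  \<open>(A\<^sub>1\<^sub>1 A\<^sub>1\<^sub>2; A\<^sub>2\<^sub>1 A\<^sub>2\<^sub>2) (1 B\<^sub>1\<^sub>2; 0 B\<^sub>2\<^sub>2) = (A\<^sub>1\<^sub>1 0; A\<^sub>2\<^sub>1 1)\<close>,
  so \<open>det A * det B\<^sub>2\<^sub>2 = det A\<^sub>1\<^sub>1\<close>.  The labels are arranged such that \<open>A\<^sub>1\<^sub>1\<close> is the
  left-hand matrix and \<open>B\<^sub>2\<^sub>2\<close> the transpose of the right-hand one.  The factor \<open>det A\<close> is the
  sign of the permutation taking \<open>c\<close> to \<open>w\<close>.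
\<close>

lemma dual_Jacobi_Trudi:
  fixes F G :: "'a::idom fps"
  assumes FG: "F * G = 1" and F0: "fps_nth F 0 = 1"
    and f: "antimono_on {..<l} f" and le: "\<And>i. i < l \<Longrightarrow> f i \<le> m"
  shows "det (mat l l (\<lambda>(i, j). coeff_ext F (int (f i) + int j - int i))) =
    (-1) ^ (\<Sum>i<l. f i) *
      det (mat m m (\<lambda>(i, j). coeff_ext G (int (conj_entry l f i) + int j - int i)))"
proof -
  let ?N = "l + m"
  define w where "w = edge_label l m f"
  define c where "c = edge_label l m (\<lambda>_. 0)"
  have c_le: "antimono_on {..<l} (\<lambda>_. 0 :: nat)" "\<And>i. i < l \<Longrightarrow> 0 \<le> m"
    by (auto simp: monotone_on_def)
  have w_perm: "w permutes {0..<?N}" and c_perm: "c permutes {0..<?N}"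
    unfolding w_def c_def using edge_label_permutes f le c_le by blast+
  have w_less: "w i < ?N" if "i < ?N" for i
    unfolding w_def using that by (rule edge_label_less)
  have c_less: "c i < ?N" if "i < ?N" for i
    unfolding c_def using that by (rule edge_label_less)
  define T where "T = mat ?N ?N (\<lambda>(i, j). coeff_ext F (int j - int i))"
  define A where "A = mat ?N ?N (\<lambda>(i, j). coeff_ext F (int (c j) - int (w i)))"
  define B where "B = mat ?N ?N (\<lambda>(i, j). if j < l then (if i = j then 1 else 0)
      else coeff_ext G (int (w j) - int (c i)))"
  define L where "L = mat l l (\<lambda>(i, j). coeff_ext F (int (f i) + int j - int i))"
  define R where "R = mat m m (\<lambda>(i, j). coeff_ext G (int (conj_entry l f i) + int j - int i))"
  have carr: "A \<in> carrier_mat ?N ?N" "B \<in> carrier_mat ?N ?N" "T \<in> carrier_mat ?N ?N"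
    "L \<in> carrier_mat l l" "R \<in> carrier_mat m m"
    by (auto simp: A_def B_def T_def L_def R_def)
  have "det A = signof w * signof c * det T"
  proof -
    have "A = mat ?N ?N (\<lambda>(i, j). T $$ (w i, c j))"
      using w_less c_less by (intro eq_matI) (auto simp: A_def T_def)
    then show ?thesis
      using det_permute_rows_cols[OF carr(3) w_perm c_perm] by simp
  qed
  also have "sign w * sign c = (-1) ^ (\<Sum>i<l. f i)"
    unfolding w_def c_def using sign_edge_label[OF f le] by (simp add: mult.assoc sign_idempotent)
  then have "(signof w * signof c :: 'a) = (-1) ^ (\<Sum>i<l. f i)"
    by (metis of_int_mult of_int_power of_int_minus of_int_1)
  finally have det_A: "det A = (-1) ^ (\<Sum>i<l. f i)"
    using det_coeff_ext_Toeplitz[OF F0] by (simp add: T_def)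
  have det_B: "det B = det R"
  proof -
    have "B = four_block_mat (1\<^sub>m l) (mat l m (\<lambda>(i, j). B $$ (i, j + l))) (0\<^sub>m m l) (R\<^sup>T)"
      by (intro eq_matI)
        (auto simp: B_def R_def w_def c_def edge_label_def conj_entry_def of_nat_diff algebra_simps
          intro!: arg_cong[of _ _ "coeff_ext G"])
    also have "det \<dots> = det R"
      using carr by (subst det_four_block_mat_lower_left_zero[of _ l _ m]) (auto simp: det_transpose)
    finally show ?thesis .
  qed
  have AB: "(A * B) $$ (i, j) = (if j < l then A $$ (i, j) else if i = j then 1 else 0)"
    if ij: "i < ?N" "j < ?N" for i j
  proof -
    have "(A * B) $$ (i, j) = (\<Sum>k<?N. A $$ (i, k) * B $$ (k, j))"
      using carr ij by (auto simp: scalar_prod_def lessThan_atLeast0)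
    also have "\<dots> = (if j < l then A $$ (i, j) else if i = j then 1 else 0)"
    proof (cases "j < l")
      case True
      then have "(\<Sum>k<?N. A $$ (i, k) * B $$ (k, j)) = (\<Sum>k<?N. if k = j then A $$ (i, j) else 0)"
        by (intro sum.cong) (auto simp: B_def)
      then show ?thesis using True by simp
    next
      case False
      have "(\<Sum>k<?N. A $$ (i, k) * B $$ (k, j)) =
          (\<Sum>k<?N. coeff_ext F (int (c k) - int (w i)) * coeff_ext G (int (w j) - int (c k)))"
        using ij False by (intro sum.cong) (auto simp: A_def B_def)
      \<comment> \<open>The columns of \<open>A\<close> and the rows of \<open>B\<close> are permuted alike.\<close>
      also have "\<dots> = (\<Sum>k<?N. coeff_ext F (int k - int (w i)) * coeff_ext G (int (w j) - int k))"
        using permutes_imp_bij[OF c_perm]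
        by (intro sum.reindex_bij_betw[of c]) (simp add: lessThan_atLeast0)
      also have "\<dots> = coeff_ext 1 (int (w j) - int (w i))"
        using coeff_ext_mult[OF w_less[OF ij(1)] w_less[OF ij(2)], of F G] FG by simp
      also have "\<dots> = (if i = j then 1 else 0)"
        using permutes_inj[OF w_perm] by (auto simp: coeff_ext_def inj_def)
      finally show ?thesis using False by simp
    qed
    finally show ?thesis .
  qed
  have "A * B = four_block_mat L (0\<^sub>m l m) (mat m l (\<lambda>(i, j). A $$ (i + l, j))) (1\<^sub>m m)"
  proof (rule eq_matI)
    fix i j assume "i < dim_row (four_block_mat L (0\<^sub>m l m) (mat m l (\<lambda>(i, j). A $$ (i + l, j))) (1\<^sub>m m))"
      "j < dim_col (four_block_mat L (0\<^sub>m l m) (mat m l (\<lambda>(i, j). A $$ (i + l, j))) (1\<^sub>m m))"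
    then have ij: "i < ?N" "j < ?N" using carr by auto
    have "A $$ (i, j) = L $$ (i, j)" if "i < l" "j < l"
      using that le[of i]
      by (auto simp: A_def L_def w_def c_def edge_label_def of_nat_diff algebra_simps
          intro!: arg_cong[of _ _ "coeff_ext F"])
    then show "(A * B) $$ (i, j) =
      four_block_mat L (0\<^sub>m l m) (mat m l (\<lambda>(i, j). A $$ (i + l, j))) (1\<^sub>m m) $$ (i, j)"
      using carr AB[OF ij] ij by auto
  qed (use carr in auto)
  also have "det \<dots> = det L"
    using carr by (subst det_four_block_mat_upper_right_zero[of _ l _ m]) auto
  finally have "det A * det B = det L"
    using det_mult[OF carr(1,2)] by simp
  then show ?thesis
    using det_A det_B by (simp add: L_def R_def)
qed

section \<open>Negating all variables\<close>

text \<open>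
  The substitution \<open>X\<^sub>i \<mapsto> -X\<^sub>i\<close>, given by its effect on coefficients because this is the form in
  which the theorem speaks of it.
\<close>

definition negate_vars :: "'k::comm_ring_1 polys \<Rightarrow> 'k polys" where
  "negate_vars p = (\<Sum>\<mu>\<in>Poly_Mapping.keys p.
     Poly_Mapping.single \<mu> ((-1) ^ exponent_size \<mu> * Poly_Mapping.lookup p \<mu>))"

lemma exponent_size_add: "exponent_size (\<mu> + \<nu>) = exponent_size \<mu> + exponent_size \<nu>"
proof -
  have *: "exponent_size \<rho> = (\<Sum>i\<in>Poly_Mapping.keys \<mu> \<union> Poly_Mapping.keys \<nu>. Poly_Mapping.lookup \<rho> i)"
    if "Poly_Mapping.keys \<rho> \<subseteq> Poly_Mapping.keys \<mu> \<union> Poly_Mapping.keys \<nu>" for \<rho>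
    unfolding exponent_size_def using that
    by (intro sum.mono_neutral_left) (auto simp: in_keys_iff)
  show ?thesis
    using Poly_Mapping.keys_add[of \<mu> \<nu>] by (simp add: * lookup_add sum.distrib)
qed

lemma lookup_flip:
  "Poly_Mapping.lookup (negate_vars p) \<mu> = (-1) ^ exponent_size \<mu> * Poly_Mapping.lookup p \<mu>"
  by (simp add: negate_vars_def lookup_sum lookup_single when_def in_keys_iff)

lemma negate_vars_single:
  "negate_vars (Poly_Mapping.single \<mu> c) = Poly_Mapping.single \<mu> ((-1) ^ exponent_size \<mu> * c)"
  by (rule poly_mapping_eqI) (auto simp: lookup_flip lookup_single when_def)

lemma negate_vars_add: "negate_vars (p + q) = negate_vars p + negate_vars q"
  by (rule poly_mapping_eqI) (simp add: lookup_flip lookup_add algebra_simps)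

lemma negate_vars_sum: "negate_vars (sum f I) = (\<Sum>i\<in>I. negate_vars (f i))"
proof (induction I rule: infinite_finite_induct)
  case (infinite I)
  then show ?case by (simp add: negate_vars_def)
next
  case empty
  then show ?case by (simp add: negate_vars_def)
qed (simp add: negate_vars_add)

lemma sum_single_lookup:
  "p = (\<Sum>\<mu>\<in>Poly_Mapping.keys p. Poly_Mapping.single \<mu> (Poly_Mapping.lookup p \<mu>))"
  by (rule poly_mapping_eqI) (simp add: lookup_sum lookup_single when_def in_keys_iff)

lemma negate_vars_mult: "negate_vars (p * q) = negate_vars p * negate_vars q"
proof -
  let ?m = "\<lambda>p \<mu>. Poly_Mapping.single \<mu> (Poly_Mapping.lookup p \<mu>)"
  have "negate_vars (p * q) =
      negate_vars ((\<Sum>\<mu>\<in>Poly_Mapping.keys p. ?m p \<mu>) * (\<Sum>\<nu>\<in>Poly_Mapping.keys q. ?m q \<nu>))"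
    by (simp flip: sum_single_lookup)
  also have "\<dots> = (\<Sum>\<mu>\<in>Poly_Mapping.keys p. \<Sum>\<nu>\<in>Poly_Mapping.keys q. negate_vars (?m p \<mu> * ?m q \<nu>))"
    by (simp add: sum_product negate_vars_sum)
  also have "\<dots> = (\<Sum>\<mu>\<in>Poly_Mapping.keys p. \<Sum>\<nu>\<in>Poly_Mapping.keys q. negate_vars (?m p \<mu>) * negate_vars (?m q \<nu>))"
    by (simp add: mult_single negate_vars_single exponent_size_add power_add algebra_simps)
  also have "\<dots> = negate_vars (\<Sum>\<mu>\<in>Poly_Mapping.keys p. ?m p \<mu>) * negate_vars (\<Sum>\<nu>\<in>Poly_Mapping.keys q. ?m q \<nu>)"
    by (simp add: negate_vars_sum sum_product)
  also have "\<dots> = negate_vars p * negate_vars q"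
    by (simp flip: sum_single_lookup)
  finally show ?thesis .
qed

lemma negate_vars_const: "negate_vars (const c) = const c"
  by (simp add: const_def negate_vars_single exponent_size_def)

lemma negate_vars_1: "negate_vars 1 = 1"
  using negate_vars_const[of 1] by (simp add: const_def)

interpretation negate_vars: comm_ring_hom "negate_vars :: 'k::comm_ring_1 polys \<Rightarrow> 'k polys"
  by unfold_locales
    (simp_all add: negate_vars_add negate_vars_mult negate_vars_1, simp add: negate_vars_def)

lemma negate_vars_var: "negate_vars (var i) = - var i"
  by (simp add: var_def negate_vars_single exponent_size_def single_uminus)

section \<open>Negating all variables inverts the generating series\<close>

lemma const_mult: "const a * const b = const (a * b)"
  by (simp add: const_def mult_single)

lemma const_of_nat: "const (of_nat n) = of_nat n"
  by (simp add: const_def)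

lemma negate_vars_of_nat: "negate_vars (of_nat n) = of_nat n"
  by (simp add: negate_vars_const flip: const_of_nat)

text \<open>
  Rising factorials satisfy the Vandermonde identity \<open>pochhammer_binomial_sum\<close> over every
  commutative ring, so this form makes the identity available for polynomials.
\<close>

lemma poly_binomial_eq_pochhammer:
  "poly_binomial (x + of_nat j - 1) j = const (1 / fact j) * pochhammer x j"
proof -
  have "(\<Prod>k<j. x + of_nat j - 1 - of_nat k) = (\<Prod>k<j. x + of_nat (j - Suc k))"
    by (intro prod.cong) (auto simp: of_nat_diff)
  also have "\<dots> = (\<Prod>k<j. x + of_nat k)"
    by (rule prod.nat_diff_reindex)
  finally show ?thesis
    by (simp add: poly_binomial_def pochhammer_prod lessThan_atLeast0)
qed

text \<open>
  \<open>(1 - t\<^sup>m)\<^sup>-\<^sup>x (1 - t\<^sup>m)\<^sup>x = 1\<close>: for \<open>m = 1\<close> the coefficient of \<open>t\<^sup>n\<close> is the rising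
  factorial of \<open>x + (-x) = 0\<close> divided by \<open>n!\<close>, which vanishes for \<open>n > 0\<close>.
\<close>

lemma neg_power_series_uminus:
  fixes x :: "'k::field_char_0 polys"
  assumes "m > 0"
  shows "neg_power_series m x * neg_power_series m (- x) = 1"
proof -
  let ?f = "\<lambda>x. Abs_fps (\<lambda>j. poly_binomial (x + of_nat j - 1) j)"
  have "?f x * ?f (- x) = 1"
  proof (rule fps_ext)
    fix n
    have scalar: "const (1 / fact i) * const (1 / fact (n - i)) =
        (const (1 / fact n) * of_nat (n choose i) :: 'k polys)" if "i \<le> n" for i
    proof -
      have "1 / fact i * (1 / fact (n - i)) = 1 / fact n * (of_nat (n choose i) :: 'k)"
        using that by (simp add: binomial_fact)
      then show ?thesis by (simp only: const_mult flip: const_of_nat)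
    qed
    have coeff: "fps_nth (?f y) j = const (1 / fact j) * pochhammer y j" for y :: "'k polys" and j
      by (simp add: poly_binomial_eq_pochhammer)
    have "fps_nth (?f x * ?f (- x)) n =
        (\<Sum>i\<le>n. (const (1 / fact i) * pochhammer x i) *
          (const (1 / fact (n - i)) * pochhammer (- x) (n - i)))"
      by (simp only: fps_mult_nth coeff atLeast0AtMost)
    also have "\<dots> = (\<Sum>i\<le>n. (const (1 / fact i) * const (1 / fact (n - i))) *
        (pochhammer x i * pochhammer (- x) (n - i)))"
      by (simp add: algebra_simps)
    also have "\<dots> = (\<Sum>i\<le>n. (const (1 / fact n) * of_nat (n choose i)) *
        (pochhammer x i * pochhammer (- x) (n - i)))"
      by (intro sum.cong) (simp_all add: scalar)
    also have "\<dots> = const (1 / fact n) * pochhammer (x + (- x)) n"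
      unfolding pochhammer_binomial_sum[of x "- x"] by (simp add: sum_distrib_left ac_simps)
    also have "\<dots> = fps_nth 1 n"
      by (simp add: pochhammer_0_left const_def)
    finally show "fps_nth (?f x * ?f (- x)) n = fps_nth 1 n" .
  qed
  then show ?thesis
    using assms by (simp add: neg_power_series_def fps_compose_mult_distrib [symmetric])
qed

definition negate_vars_fps :: "'k::comm_ring_1 polys fps \<Rightarrow> 'k polys fps" where
  "negate_vars_fps F = Abs_fps (\<lambda>n. negate_vars (fps_nth F n))"

lemma negate_vars_fps_nth [simp]: "fps_nth (negate_vars_fps F) n = negate_vars (fps_nth F n)"
  by (simp add: negate_vars_fps_def)

lemma negate_vars_fps_mult:
  "negate_vars_fps (F * G) = negate_vars_fps F * negate_vars_fps G"
  by (rule fps_ext) (simp add: fps_mult_nth negate_vars.hom_sum negate_vars.hom_mult)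

lemma negate_vars_fps_neg_power_series:
  assumes "m > 0"
  shows "negate_vars_fps (neg_power_series m x) = neg_power_series m (negate_vars x)"
proof (rule fps_ext)
  fix n
  have "negate_vars (poly_binomial y j) = poly_binomial (negate_vars y) j" for y :: "'a polys" and j
    by (simp add: poly_binomial_def negate_vars.hom_mult negate_vars_const negate_vars.hom_prod
        negate_vars.hom_minus negate_vars_of_nat)
  then show "fps_nth (negate_vars_fps (neg_power_series m x)) n =
      fps_nth (neg_power_series m (negate_vars x)) n"
    using assms
    by (simp add: neg_power_series_nth negate_vars.hom_minus negate_vars.hom_add negate_vars_of_nat)
qed

text \<open>
  Convergence is coefficientwise stabilization, which reduces identities for the infinite product
  to finite products.
\<close>

lemma H_series_nth_eq_partial_product:
  "\<exists>N. \<forall>k\<le>n. fps_nth (\<Prod>i\<le>N. neg_power_series (Suc i) (var i)) k =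
     fps_nth (H_series :: 'k::field_char_0 polys fps) k"
proof -
  let ?p = "\<lambda>N. \<Prod>i\<le>N. neg_power_series (Suc i) (var i :: 'k polys)"
  have "?p \<longlonglongrightarrow> H_series"
    using has_prod_imp_tendsto[OF has_prod_H_series] .
  then have "\<forall>\<^sub>F N in sequentially. \<forall>k\<in>{0..n}. fps_nth (?p N) k = fps_nth H_series k"
    by (intro eventually_ball_finite) (auto simp: tendsto_fps_iff)
  then show ?thesis
    by (fastforce simp: eventually_sequentially)
qed

lemma negate_vars_fps_H_series_mult:
  "negate_vars_fps H_series * H_series = (1 :: 'k::field_char_0 polys fps)"
proof (rule fps_ext)
  fix n
  define f where "f i = neg_power_series (Suc i) (var i :: 'k polys)" for i
  define p where "p N = (\<Prod>i\<le>N. f i)" for N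
  obtain N where N: "\<And>k. k \<le> n \<Longrightarrow> fps_nth (p N) k = fps_nth H_series k"
    using H_series_nth_eq_partial_product[of n, where 'k = 'k] unfolding p_def f_def by blast
  have f: "negate_vars_fps (f i) * f i = 1" for i
    using neg_power_series_uminus[of "Suc i" "var i :: 'k polys"]
    by (simp add: f_def negate_vars_fps_neg_power_series negate_vars_var mult.commute)
  have "negate_vars_fps (p M) * p M = 1" for M
  proof (induction M)
    case 0
    show ?case using f[of 0] by (simp add: p_def)
  next
    case (Suc M)
    have "negate_vars_fps (p (Suc M)) * p (Suc M) =
       (negate_vars_fps (p M) * p M) * (negate_vars_fps (f (Suc M)) * f (Suc M))"
      by (simp add: p_def negate_vars_fps_mult algebra_simps)
    then show ?case using Suc f by simp
  qed
  then have "fps_nth (1 :: 'k polys fps) n = fps_nth (negate_vars_fps (p N) * p N) n"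
    by simp
  also have "\<dots> = fps_nth (negate_vars_fps H_series * H_series) n"
    unfolding fps_mult_nth by (intro sum.cong) (auto simp: N)
  finally show "fps_nth (negate_vars_fps H_series * H_series) n = fps_nth (1 :: 'k polys fps) n"
    by simp
qed

lemma H_poly_eq: "H_poly = coeff_ext H_series"
  by (simp add: fun_eq_iff H_poly_def coeff_ext_def)

lemma H_series_nth_0: "fps_nth H_series 0 = (1 :: 'k::field_char_0 polys)"
proof -
  obtain N where
    "fps_nth (\<Prod>i\<le>N. neg_power_series (Suc i) (var i :: 'k polys)) 0 = fps_nth H_series 0"
    using H_series_nth_eq_partial_product[of 0] by blast
  then show ?thesis
    by (simp add: fps_prod_nth' neg_power_series_nth_less)
qed

section \<open>Conjugation of partitions\<close>

text \<open>
  The dual Jacobi-Trudi identity for the mutually inverse series \<open>\<sigma>(H)\<close> and \<open>H\<close>, since a ring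
  homomorphism commutes with determinants.
\<close>

lemma S_poly_conj_partition:
  assumes "is_partition lam"
  shows "S_poly (conj_partition lam) = (-1) ^ sum_list lam * negate_vars (S_poly lam)"
proof -
  let ?F = "negate_vars_fps H_series :: 'a polys fps"
  let ?f = "\<lambda>i. lam ! i" and ?l = "length lam"
  define m where "m = foldr max lam 0"
  have le: "lam ! i \<le> m" if "i < length lam" for i
  proof -
    have "x \<le> foldr max xs 0" if "x \<in> set xs" for x :: nat and xs
      using that by (induction xs) auto
    then show ?thesis using that by (simp add: m_def)
  qed
  have anti: "antimono_on {..<?l} ?f"
    using assms by (auto simp: is_partition_def monotone_on_def sorted_wrt_iff_nth_less le_less)
  have F0: "fps_nth ?F 0 = 1"
    by (simp add: H_series_nth_0)
  have conj_nth: "conj_partition lam ! j = conj_entry ?l ?f j" if "j < m" for j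
    using that by (simp add: conj_partition_def conj_entry_def Suc_le_eq flip: m_def del: upt_Suc)
  have conj_len: "length (conj_partition lam) = m"
    by (simp add: conj_partition_def flip: m_def)
  have negate_vars_coeff: "negate_vars (coeff_ext H_series d) = coeff_ext ?F d" for d
    by (simp add: coeff_ext_def)
  have "negate_vars (S_poly lam) =
      det (map_mat negate_vars (mat ?l ?l (\<lambda>(i, j). H_poly (int (lam ! i) + int j - int i))))"
    by (simp add: S_poly_def)
  also have "\<dots> = det (mat ?l ?l (\<lambda>(i, j). coeff_ext ?F (int (lam ! i) + int j - int i)))"
    by (intro arg_cong[of _ _ det] eq_matI) (auto simp: H_poly_eq negate_vars_coeff)
  also have "\<dots> = (-1) ^ (\<Sum>i<?l. lam ! i) *
      det (mat m m (\<lambda>(i, j). coeff_ext H_series (int (conj_entry ?l ?f i) + int j - int i)))"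
    by (rule dual_Jacobi_Trudi[OF negate_vars_fps_H_series_mult F0 anti le])
  also have "(\<Sum>i<?l. lam ! i) = sum_list lam"
    by (simp add: sum_list_sum_nth lessThan_atLeast0)
  also have "mat m m (\<lambda>(i, j). coeff_ext H_series (int (conj_entry ?l ?f i) + int j - int i)) =
      mat m m (\<lambda>(i, j). H_poly (int (conj_partition lam ! i) + int j - int i))"
    by (intro eq_matI) (auto simp: conj_nth H_poly_eq)
  also have "det \<dots> = S_poly (conj_partition lam)"
    by (simp add: S_poly_def conj_len)
  finally show ?thesis
    by (simp add: flip: mult.assoc power_mult_distrib)
qed

theorem theorem2p11:
  fixes lam :: "nat list"
    and a :: "exponent \<Rightarrow> 'k::field_char_0"
  assumes "is_partition lam"
    and "finite {\<mu>. a \<mu> \<noteq> 0}"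
    and "S_poly lam = (\<Sum>\<mu> | a \<mu> \<noteq> 0. Poly_Mapping.single \<mu> (a \<mu>))"
  shows "S_poly (conj_partition lam) =
    (\<Sum>\<mu> | a \<mu> \<noteq> 0. Poly_Mapping.single \<mu>
       ((-1) powi (int (sum_list lam) - int (exponent_size \<mu>)) * a \<mu>))"
proof -
  have sgn: "(-1) powi (int n - int k) = (-1 :: 'k) ^ n * (-1) ^ k" for n k
    by (cases "even k") (simp_all add: power_int_diff)
  have "(-1 :: 'k polys) ^ n = const ((-1) ^ n)" for n
    by (induction n) (simp_all add: const_def mult_single single_uminus)
  then have "S_poly (conj_partition lam) = const ((-1) ^ sum_list lam) *
      negate_vars (\<Sum>\<mu> | a \<mu> \<noteq> 0. Poly_Mapping.single \<mu> (a \<mu>))"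
    using S_poly_conj_partition[OF assms(1), where 'a = 'k] assms(3) by simp
  also have "\<dots> = (\<Sum>\<mu> | a \<mu> \<noteq> 0. Poly_Mapping.single \<mu>
       ((-1) powi (int (sum_list lam) - int (exponent_size \<mu>)) * a \<mu>))"
    by (simp add: sgn negate_vars_sum sum_distrib_left negate_vars_single const_def mult_single mult.assoc)
  finally show ?thesis .
qed

end
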